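(* Let $m\in\mathbb{N}$ be an odd positive integer and let $K\subset\mathbb{R}^2$ be a polygon with $N$ edges, where $N$ is even. Let $\{\pi_n\}_{n\in\mathbb{N}_0}$ be a sequence of orthogonal polynomials on $[-1,1]$ with respect to a weight function $\omega$, with $\pi_n(t)=\sum_{\nu=0}^n\gamma_\nu^{(n)}t^\nu$. For any interval $[a,b]$, let $\pi_{n,a,b}(x)=\pi_n(\varphi(x))$, $n\in\mathbb{N}_0$, denote the corresponding rescaled polynomials on $[a,b]$, where $\varphi(x)=\frac{a+b-2x}{a-b}$. Then the following statements are equivalent: (1) The triple $\mathcal A_{m,N}$ (built with the interval $[a,b]$ and the weight $\omega\circ\varphi$) defines a finite element; (2) $\pi_{m,a,b}(b)+\pi_{m,a,b}(a)\neq0$; (3) The polynomial $\widetilde p_m(x)=\frac{a+b-2x}{a-b}\,\pi_{m,a,b}'(x)-\frac{2}{a-b}\,\pi_{m,a,b}(x)$ is not orthogonal to the constant functions on $[a,b]$ with respect to the constant weight function $1$, i.e. $\int_a^b\widetilde p_m(x)\,dx\neq0$; (4) $\displaystyle\sum_{\substack{\nu=0\\ \nu\ \mathrm{even}}}^m\gamma_\nu^{(m)}\neq0$.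
   Context: $\mathbb{N}=\{1,2,\dots\}$, $\mathbb{N}_0=\mathbb{N}\cup\{0\}$, $a<b$ are real numbers. A weight function on a bounded interval is a nonnegative integrable function with strictly positive integral and finite moments. A sequence of real polynomials $\{\pi_n\}_{n\in\mathbb{N}_0}$ is orthogonal on an interval with respect to $\omega$ if $\deg\pi_n=n$ and $\int\pi_m\pi_n\omega=K_n\delta_{mn}$ with $K_n\ne0$. The affine map $\varphi$ sends $[a,b]$ onto $[-1,1]$, and $\{\pi_{n,a,b}\}$ is orthogonal on $[a,b]$ with respect to $\omega\circ\varphi$. $K$ has vertices $\mathbf v_1,\dots,\mathbf v_N$ ordered counter-clockwise, edges $e_i=[\mathbf v_i,\mathbf v_{i+1}]$, $\mathbf v_{N+1}=\mathbf v_1$. With $\psi_i(x)=\frac{b-x}{b-a}\mathbf v_i+\frac{x-a}{b-a}\mathbf v_{i+1}$, $x\in[a,b]$, put $\widetilde\gamma_i(u)(x)=u|_{e_i}(\psi_i(x))$. $\mathcal{S}_m(\partial K)$ is the space of $f\in L^2(\partial K)$ such that $f|_{e_i}$ is a polynomial of degree at most $m$ for each $i$ (no continuity at vertices), and $\mathcal{S}_m^0(\partial K)=\mathcal{S}_m(\partial K)\cap C^0(\partial K)$, of dimension $mN$. Given a basis $\{b_j\}_{j=1}^{mN}$ of $\mathcal{S}_{m-1}(\partial K)$, the triple built with $[a,b]$ and a weight $w$ on $[a,b]$ is $\mathcal A_{m,N}=(\partial K,\mathcal{S}_m^0(\partial K),\Sigma_{\partial K})$, $\Sigma_{\partial K}=\{\mathcal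 L_j\}_{j=1}^{mN}$, $\mathcal L_j(f)=\sum_{i=1}^N\int_a^b\widetilde\gamma_i(f)\widetilde\gamma_i(b_j)\,w\,dx$. It "defines a finite element" if the only $p\in\mathcal{S}_m^0(\partial K)$ with $\mathcal L_j(p)=0$ for all $j$ is $p=0$. *)

theory Defs
  imports "HOL-Analysis.Analysis" "HOL-Computational_Algebra.Polynomial"
begin

definition weight_function :: "real \<Rightarrow> real \<Rightarrow> (real \<Rightarrow> real) \<Rightarrow> bool" where
  "weight_function a b w \<longleftrightarrow>
     (\<forall>x\<in>{a..b}. 0 \<le> w x) \<and>
     w absolutely_integrable_on {a..b} \<and>
     0 < (LINT x:{a..b}|lebesgue. w x) \<and>
     (\<forall>n. (\<lambda>x. x ^ n * w x) absolutely_integrable_on {a..b})"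

definition orthogonal_polynomials ::
  "real \<Rightarrow> real \<Rightarrow> (real \<Rightarrow> real) \<Rightarrow> (nat \<Rightarrow> real poly) \<Rightarrow> bool" where
  "orthogonal_polynomials a b w \<pi> \<longleftrightarrow>
     (\<forall>n. degree (\<pi> n) = n) \<and>
     (\<exists>K. (\<forall>n. K n \<noteq> 0) \<and>
       (\<forall>m n. (LINT x:{a..b}|lebesgue. poly (\<pi> m) x * poly (\<pi> n) x * w x) =
                (if m = n then K n else 0)))"

definition affine_map :: "real \<Rightarrow> real \<Rightarrow> real \<Rightarrow> real" where
  "affine_map a b x = (a + b - 2 * x) / (a - b)"

definition rescaled :: "(nat \<Rightarrow> real poly) \<Rightarrow> nat \<Rightarrow> real \<Rightarrow> real \<Rightarrow> real \<Rightarrow> real" where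
  "rescaled \<pi> n a b x = poly (\<pi> n) (affine_map a b x)"

definition p_tilde :: "(nat \<Rightarrow> real poly) \<Rightarrow> nat \<Rightarrow> real \<Rightarrow> real \<Rightarrow> real \<Rightarrow> real" where
  "p_tilde \<pi> m a b x =
     (a + b - 2 * x) / (a - b) * deriv (rescaled \<pi> m a b) x
       - 2 / (a - b) * rescaled \<pi> m a b x"

definition edge :: "(nat \<Rightarrow> real^2) \<Rightarrow> nat \<Rightarrow> (real^2) set" where
  "edge v i = closed_segment (v i) (v (i + 1))"

text \<open>
  A polygon with vertices \<open>v 1, \<dots>, v N\<close>, in counter-clockwise order, is the compact region
  bounded by the simple closed polygonal chain with these vertices.  The penultimate condition
  says that two distinct edges meet at most in a common vertex; the last one (twice the
  signed area is positive) fixes the orientation.  The values of \<open>v\<close> outside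
  \<open>{1..N + 1}\<close> are irrelevant.
\<close>

definition polygon :: "(real^2) set \<Rightarrow> nat \<Rightarrow> (nat \<Rightarrow> real^2) \<Rightarrow> bool" where
  "polygon K N v \<longleftrightarrow>
     3 \<le> N \<and> v (N + 1) = v 1 \<and>
     compact K \<and> interior K \<noteq> {} \<and> frontier K = (\<Union>i\<in>{1..N}. edge v i) \<and>
     inj_on v {1..N} \<and>
     (\<forall>i\<in>{1..N}. \<forall>j\<in>{1..N}. i \<noteq> j \<longrightarrow>
        edge v i \<inter> edge v j = {v i, v (i + 1)} \<inter> {v j, v (j + 1)}) \<and>
     0 < (\<Sum>i=1..N. v i $ 1 * v (i + 1) $ 2 - v (i + 1) $ 1 * v i $ 2)"

definition edge_map :: "(nat \<Rightarrow> real^2) \<Rightarrow> real \<Rightarrow> real \<Rightarrow> nat \<Rightarrow> real \<Rightarrow> real^2" where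
  "edge_map v a b i x = ((b - x) / (b - a)) *\<^sub>R v i + ((x - a) / (b - a)) *\<^sub>R v (i + 1)"

definition edge_trace ::
  "(nat \<Rightarrow> real^2) \<Rightarrow> real \<Rightarrow> real \<Rightarrow> nat \<Rightarrow> (real^2 \<Rightarrow> real) \<Rightarrow> real \<Rightarrow> real" where
  "edge_trace v a b i u x = u (edge_map v a b i x)"

text \<open>
  Elements of \<open>L\<^sup>2(\<partial>K)\<close> are represented by functions on the plane, of which only the values
  on the boundary matter, and these only up to equality almost everywhere with respect to arc
  length.  Each edge is parametrized over \<open>[0,1]\<close> with constant speed, so arc length on it is
  a positive multiple of Lebesgue measure in the parameter.
\<close>

definition boundary_L2 :: "nat \<Rightarrow> (nat \<Rightarrow> real^2) \<Rightarrow> (real^2 \<Rightarrow> real) set" where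
  "boundary_L2 N v = {f. \<forall>i\<in>{1..N}.
     (\<lambda>t. f (linepath (v i) (v (i + 1)) t)) \<in> borel_measurable (lebesgue_on {0..1}) \<and>
     (\<lambda>t. (f (linepath (v i) (v (i + 1)) t))\<^sup>2) absolutely_integrable_on {0..1}}"

definition boundary_eq ::
  "nat \<Rightarrow> (nat \<Rightarrow> real^2) \<Rightarrow> (real^2 \<Rightarrow> real) \<Rightarrow> (real^2 \<Rightarrow> real) \<Rightarrow> bool" where
  "boundary_eq N v f g \<longleftrightarrow> (\<forall>i\<in>{1..N}. AE t in lebesgue_on {0..1}.
     f (linepath (v i) (v (i + 1)) t) = g (linepath (v i) (v (i + 1)) t))"

text \<open>
  The restriction to an edge is required to be a polynomial only almost everywhere; with
  pointwise equality on the closed edges, membership would force agreement at the vertices.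
\<close>

definition S_space :: "nat \<Rightarrow> (nat \<Rightarrow> real^2) \<Rightarrow> nat \<Rightarrow> (real^2 \<Rightarrow> real) set" where
  "S_space N v m = {f \<in> boundary_L2 N v. \<forall>i\<in>{1..N}. \<exists>q :: real poly. degree q \<le> m \<and>
     (AE t in lebesgue_on {0..1}. f (linepath (v i) (v (i + 1)) t) = poly q t)}"

definition S0_space ::
  "(real^2) set \<Rightarrow> nat \<Rightarrow> (nat \<Rightarrow> real^2) \<Rightarrow> nat \<Rightarrow> (real^2 \<Rightarrow> real) set" where
  "S0_space K N v m = {f \<in> S_space N v m. continuous_on (frontier K) f}"

text \<open>Linear independence and spanning are understood in \<open>L\<^sup>2(\<partial>K)\<close>, i.e. up to \<open>boundary_eq\<close>.\<close>

definition basis_of_S ::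
  "nat \<Rightarrow> (nat \<Rightarrow> real^2) \<Rightarrow> nat \<Rightarrow> nat \<Rightarrow> (nat \<Rightarrow> real^2 \<Rightarrow> real) \<Rightarrow> bool" where
  "basis_of_S N v k d \<beta> \<longleftrightarrow>
     (\<forall>j\<in>{1..d}. \<beta> j \<in> S_space N v k) \<and>
     (\<forall>c. boundary_eq N v (\<lambda>x. \<Sum>j=1..d. c j * \<beta> j x) (\<lambda>x. 0) \<longrightarrow> (\<forall>j\<in>{1..d}. c j = 0)) \<and>
     (\<forall>f\<in>S_space N v k. \<exists>c. boundary_eq N v f (\<lambda>x. \<Sum>j=1..d. c j * \<beta> j x))"

definition dof ::
  "nat \<Rightarrow> (nat \<Rightarrow> real^2) \<Rightarrow> real \<Rightarrow> real \<Rightarrow> (real \<Rightarrow> real) \<Rightarrow> (nat \<Rightarrow> real^2 \<Rightarrow> real) \<Rightarrow>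
     nat \<Rightarrow> (real^2 \<Rightarrow> real) \<Rightarrow> real" where
  "dof N v a b w \<beta> j f =
     (\<Sum>i=1..N. LINT x:{a..b}|lebesgue. edge_trace v a b i f x * edge_trace v a b i (\<beta> j) x * w x)"

type_synonym element_triple =
  "(real^2) set \<times> (real^2 \<Rightarrow> real) set \<times> ((real^2 \<Rightarrow> real) \<Rightarrow> real) set"

definition A_triple ::
  "(real^2) set \<Rightarrow> nat \<Rightarrow> (nat \<Rightarrow> real^2) \<Rightarrow> nat \<Rightarrow> real \<Rightarrow> real \<Rightarrow> (real \<Rightarrow> real) \<Rightarrow>
     (nat \<Rightarrow> real^2 \<Rightarrow> real) \<Rightarrow> element_triple" where
  "A_triple K N v m a b w \<beta> = (frontier K, S0_space K N v m, dof N v a b w \<beta> ` {1..m * N})"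

definition defines_finite_element :: "element_triple \<Rightarrow> bool" where
  "defines_finite_element = (\<lambda>(D, P, \<Sigma>).
     \<forall>p\<in>P. (\<forall>L\<in>\<Sigma>. L p = 0) \<longrightarrow> (\<forall>x\<in>D. p x = 0))"

end

theory Submission
  imports Defs
begin

text \<open>
  Let \<open>p\<close> be a continuous, edgewise polynomial function of degree at most \<open>m\<close> on the
  boundary of the polygon.  The test functions may be chosen independently on the edges, so all
  degrees of freedom of \<open>p\<close> vanish iff on every edge \<open>p\<close> is orthogonal to the
  polynomials of degree less than \<open>m\<close> (\<open>all_dofs_zero_iff\<close>), that is, iff in the
  parameter scaled to \<open>[-1, 1]\<close> it is a multiple \<open>c i\<close> of \<open>\<pi> m\<close> on edge number
  \<open>i\<close> (\<open>orthogonal_to_lower_degree_imp_multiple\<close>).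

  Continuity at the vertices then means that \<open>c i\<close> times the value of \<open>\<pi> m\<close> at
  \<open>1\<close> is \<open>c (i + 1)\<close> times its value at \<open>-1\<close>, cyclically in \<open>i\<close>.  If the
  absolute values of \<open>\<pi> m\<close> at \<open>1\<close> and \<open>-1\<close> differ, adding up the absolute
  values of these equations forces all \<open>c i\<close> to be zero (\<open>unisolvent\<close>).  If the two
  values are opposite and the number of edges is even, alternating signs give a nonzero solution
  (\<open>not_unisolvent\<close>).  It remains to exclude that the two values are equal and nonzero.
  For odd \<open>m\<close> this follows from the classical argument that compares a polynomial with the
  product of the linear factors of its roots in the interval
  (\<open>orthogonal_polynomial_endpoint_signs\<close>).

  Hence the element is well defined iff the values of \<open>\<pi> m\<close> at \<open>1\<close> and \<open>-1\<close> do
  not add up to zero.  Their sum is the integral of \<open>p_tilde\<close> by the fundamental theorem of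
  calculus (\<open>integral_p_tilde\<close>), and twice the sum of the coefficients with even index
  (\<open>poly_1_add_poly_minus_1\<close>).
\<close>

section \<open>Moments of polynomials against the weight\<close>

text \<open>The integral over \<open>[-1, 1]\<close> of a polynomial against the weight.\<close>

definition moment :: "(real \<Rightarrow> real) \<Rightarrow> real poly \<Rightarrow> real" where
  "moment \<omega> q = (LINT x:{-1..1}|lebesgue. poly q x * \<omega> x)"

lemma weight_poly_integrable:
  assumes "weight_function (-1) 1 \<omega>"
  shows "set_integrable lebesgue {-1..1} (\<lambda>x. poly q x * \<omega> x)"
proof -
  have *: "\<And>n. (\<lambda>x. x ^ n * \<omega> x) absolutely_integrable_on {-1..1}"
    using assms by (auto simp: weight_function_def)
  have "(\<lambda>x. \<Sum>i\<le>degree q. coeff q i *\<^sub>R (x ^ i * \<omega> x)) absolutely_integrable_on {-1..1}"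
    by (intro absolutely_integrable_sum absolutely_integrable_scaleR_left *) auto
  moreover have "(\<lambda>x. \<Sum>i\<le>degree q. coeff q i *\<^sub>R (x ^ i * \<omega> x)) = (\<lambda>x. poly q x * \<omega> x)"
    by (auto simp: poly_altdef sum_distrib_right mult.assoc)
  ultimately show ?thesis by simp
qed

lemma moment_0 [simp]: "moment \<omega> 0 = 0"
  by (simp add: moment_def)

lemma moment_smult [simp]: "moment \<omega> (smult c q) = c * moment \<omega> q"
  by (simp add: moment_def mult.assoc)

lemma moment_add:
  assumes "weight_function (-1) 1 \<omega>"
  shows "moment \<omega> (p + q) = moment \<omega> p + moment \<omega> q"
  using set_integral_add(2)[OF weight_poly_integrable[OF assms, of p]
      weight_poly_integrable[OF assms, of q]]
  by (simp add: moment_def algebra_simps)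

lemma moment_sum:
  assumes "weight_function (-1) 1 \<omega>"
  shows "moment \<omega> (\<Sum>j\<in>A. f j) = (\<Sum>j\<in>A. moment \<omega> (f j))"
  by (induction A rule: infinite_finite_induct) (auto simp: moment_add[OF assms])

lemma moment_nonneg_eq_0:
  assumes w: "weight_function (-1) 1 \<omega>"
    and nonneg: "\<And>x. -1 \<le> x \<Longrightarrow> x \<le> 1 \<Longrightarrow> 0 \<le> poly q x" and 0: "moment \<omega> q = 0"
  shows "q = 0"
proof (rule ccontr)
  assume q: "q \<noteq> 0"
  have "AE x in lebesgue. indicator {-1..1} x *\<^sub>R (poly q x * \<omega> x) = 0"
  proof (subst integral_nonneg_eq_0_iff_AE[symmetric])
    show "integrable lebesgue (\<lambda>x. indicat_real {-1..1} x *\<^sub>R (poly q x * \<omega> x))"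
      using weight_poly_integrable[OF w] by (simp add: set_integrable_def)
    show "AE x in lebesgue. 0 \<le> indicat_real {-1..1} x *\<^sub>R (poly q x * \<omega> x)"
      using w nonneg by (intro AE_I2) (auto simp: indicator_def weight_function_def)
    show "(LINT x|lebesgue. indicat_real {-1..1} x *\<^sub>R (poly q x * \<omega> x)) = 0"
      using 0 by (simp add: moment_def set_lebesgue_integral_def)
  qed
  moreover have "AE x in lebesgue. x \<notin> {x. poly q x = 0}"
    using poly_roots_finite[OF q]
    by (intro AE_not_in) (simp add: negligible_iff_null_sets[symmetric] negligible_finite)
  ultimately have "AE x in lebesgue. indicator {-1..1} x *\<^sub>R \<omega> x = 0"
    by eventually_elim auto
  then have "(LINT x|lebesgue. indicator {-1..1} x *\<^sub>R \<omega> x) = 0"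
    by (rule integral_eq_zero_AE)
  with w show False
    by (simp add: weight_function_def set_lebesgue_integral_def)
qed

section \<open>Orthogonal polynomials\<close>

lemma orthogonal_polynomial_nonzero:
  assumes "orthogonal_polynomials (-1) 1 \<omega> \<pi>"
  shows "\<pi> n \<noteq> 0"
proof
  assume "\<pi> n = 0"
  then have "(LINT x:{-1..1}|lebesgue. poly (\<pi> n) x * poly (\<pi> n) x * \<omega> x) = 0"
    by simp
  moreover have "(LINT x:{-1..1}|lebesgue. poly (\<pi> n) x * poly (\<pi> n) x * \<omega> x) \<noteq> 0"
    using assms unfolding orthogonal_polynomials_def by force
  ultimately show False by contradiction
qed

text \<open>
  The proof is by induction on \<open>k\<close>, a strict bound for the degree of \<open>q\<close>, subtracting a multiple of
  \<open>\<pi> k\<close> to cancel the leading coefficient.  The bound is expressed by vanishing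
  coefficients, because the degree of the zero polynomial is 0.
\<close>

lemma orthogonal_to_lower_degree:
  assumes w: "weight_function (-1) 1 \<omega>" and orth: "orthogonal_polynomials (-1) 1 \<omega> \<pi>"
    and "degree q < n"
  shows "moment \<omega> (\<pi> n * q) = 0"
proof -
  have deg: "\<And>n. degree (\<pi> n) = n"
    using orth by (simp add: orthogonal_polynomials_def)
  have \<pi>0: "moment \<omega> (\<pi> n * \<pi> k) = 0" if "k < n" for k
    using orth that by (auto simp: orthogonal_polynomials_def moment_def)
  have "moment \<omega> (\<pi> n * q) = 0" if "k \<le> n" "\<And>i. i \<ge> k \<Longrightarrow> coeff q i = 0" for k q
    using that
  proof (induction k arbitrary: q)
    case 0
    then have "q = 0" by (simp add: poly_eqI)
    then show ?case by simp
  next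
    case (Suc k)
    define c where "c = coeff q k / coeff (\<pi> k) k"
    define r where "r = q - smult c (\<pi> k)"
    have lead: "coeff (\<pi> k) k \<noteq> 0"
      using orthogonal_polynomial_nonzero[OF orth, of k] deg[of k] leading_coeff_neq_0 by metis
    have "coeff r i = 0" if "i \<ge> k" for i
    proof (cases "i = k")
      case True
      then show ?thesis using lead by (simp add: r_def c_def)
    next
      case False
      then show ?thesis using that Suc.prems(2)[of i] deg[of k]
        by (simp add: r_def coeff_eq_0)
    qed
    then have "moment \<omega> (\<pi> n * r) = 0"
      using Suc.IH Suc.prems by simp
    moreover have "\<pi> n * q = \<pi> n * r + smult c (\<pi> n * \<pi> k)"
      by (simp add: r_def algebra_simps)
    ultimately show ?case
      using \<pi>0[of k] Suc.prems by (simp add: moment_add[OF w])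
  qed
  from this[of n q] show ?thesis
    using assms(3) by (simp add: coeff_eq_0)
qed

text \<open>
  The orthogonal complement of the polynomials of degree less than \<open>n\<close> in those of degree
  at most \<open>n\<close> is spanned by \<open>\<pi> n\<close>: the remainder \<open>s\<close> after cancelling the
  leading coefficient is orthogonal to itself.
\<close>

lemma orthogonal_to_lower_degree_imp_multiple:
  assumes w: "weight_function (-1) 1 \<omega>" and orth: "orthogonal_polynomials (-1) 1 \<omega> \<pi>"
    and "degree q \<le> n" "0 < n" and 0: "\<And>r. degree r < n \<Longrightarrow> moment \<omega> (q * r) = 0"
  shows "\<exists>c. q = smult c (\<pi> n)"
proof -
  define c where "c = coeff q n / coeff (\<pi> n) n"
  define s where "s = q - smult c (\<pi> n)"
  have deg: "degree (\<pi> n) = n"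
    using orth by (simp add: orthogonal_polynomials_def)
  then have "coeff (\<pi> n) n \<noteq> 0"
    using orthogonal_polynomial_nonzero[OF orth, of n] leading_coeff_neq_0 by metis
  then have "coeff s n = 0"
    by (simp add: s_def c_def)
  moreover have "degree s \<le> n"
    unfolding s_def using deg assms(3) by (intro degree_diff_le) auto
  ultimately have s: "degree s < n"
    using \<open>0 < n\<close> by (metis degree_0 le_neq_implies_less leading_coeff_0_iff)
  have "s * s = (q - smult c (\<pi> n)) * s"
    by (simp add: s_def)
  then have ss: "s * s = q * s + smult (- c) (\<pi> n * s)"
    by (simp add: left_diff_distrib)
  have "moment \<omega> (s * s) = 0"
    unfolding ss moment_add[OF w] moment_smult
    using 0[OF s] orthogonal_to_lower_degree[OF w orth s] by simp
  then have "s * s = 0"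
    by (intro moment_nonneg_eq_0[OF w]) auto
  then show ?thesis
    by (auto simp: s_def)
qed

text \<open>
  The polynomial \<open>q\<close> is, up to sign, the product of the linear factors of \<open>p\<close> that belong to
  roots in the open interval \<open>(-1, 1)\<close>, with multiplicities.  Each of these factors has
  opposite signs at \<open>-1\<close> and \<open>1\<close>, which links the parity of the degree of \<open>q\<close>
  to its signs at the endpoints.
\<close>

lemma poly_sign_factor:
  fixes p :: "real poly"
  assumes "p \<noteq> 0"
  shows "\<exists>q. q \<noteq> 0 \<and> degree q \<le> degree p \<and> (\<forall>x. -1 \<le> x \<and> x \<le> 1 \<longrightarrow> 0 \<le> poly p x * poly q x) \<and>
             (-1) ^ degree q * (poly q 1 * poly q (-1)) > 0"
  using assms
proof (induction "degree p" arbitrary: p rule: less_induct)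
  case less
  show ?case
  proof (cases "\<exists>r. -1 < r \<and> r < 1 \<and> poly p r = 0")
    case True
    then obtain r where r: "-1 < r" "r < 1" "poly p r = 0" by auto
    then obtain p' where p': "p = [:-r, 1:] * p'"
      by (metis dvd_def poly_eq_0_iff_dvd)
    then have "p' \<noteq> 0" using less.prems by auto
    then have deg: "degree p = Suc (degree p')"
      unfolding p' by (subst degree_mult_eq) auto
    then obtain q where q: "q \<noteq> 0" "degree q \<le> degree p'"
      "\<And>x. -1 \<le> x \<Longrightarrow> x \<le> 1 \<Longrightarrow> 0 \<le> poly p' x * poly q x"
      "(-1) ^ degree q * (poly q 1 * poly q (-1)) > 0"
      using less.hyps[of p'] \<open>p' \<noteq> 0\<close> by auto
    have degq: "degree ([:-r, 1:] * q) = Suc (degree q)"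
      using \<open>q \<noteq> 0\<close> by (subst degree_mult_eq) auto
    show ?thesis
    proof (intro exI[of _ "[:-r, 1:] * q"] conjI allI impI)
      show "[:-r, 1:] * q \<noteq> 0" using degq by force
      show "degree ([:-r, 1:] * q) \<le> degree p" using deg degq q by simp
      show "0 \<le> poly p x * poly ([:-r, 1:] * q) x" if "-1 \<le> x \<and> x \<le> 1" for x
      proof -
        have "poly p x * poly ([:-r, 1:] * q) x = (x - r)\<^sup>2 * (poly p' x * poly q x)"
          unfolding p' by (simp add: power2_eq_square algebra_simps)
        then show ?thesis using q(3)[of x] that by simp
      qed
      have "(-1) ^ degree ([:-r, 1:] * q) * (poly ([:-r, 1:] * q) 1 * poly ([:-r, 1:] * q) (-1))
            = ((1 - r) * (1 + r)) * ((-1) ^ degree q * (poly q 1 * poly q (-1)))"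
        unfolding degq poly_mult power_Suc by simp argo
      also have "\<dots> > 0" using r by (intro mult_pos_pos[OF mult_pos_pos q(4)]) auto
      finally show "(-1) ^ degree ([:-r, 1:] * q) *
          (poly ([:-r, 1:] * q) 1 * poly ([:-r, 1:] * q) (-1)) > 0" .
    qed
  next
    case False
    define c where "c = sgn (poly p 0)"
    have p0: "poly p 0 \<noteq> 0" using False by force
    have open_int: "0 \<le> c * poly p x" if "x \<in> {-1<..<1}" for x
    proof (rule ccontr)
      assume "\<not> 0 \<le> c * poly p x"
      then have "poly p 0 * poly p x < 0"
        by (auto simp: c_def sgn_if not_le mult_less_0_iff split: if_splits)
      then have x: "poly p 0 * poly p x < 0" "poly p x * poly p 0 < 0"
        by (simp_all add: mult.commute)
      then have "x \<noteq> 0"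
        by (auto simp: mult_less_0_iff)
      then consider "0 < x" | "x < 0"
        by linarith
      then have "\<exists>r. -1 < r \<and> r < 1 \<and> poly p r = 0"
      proof cases
        case 1
        with x(1) poly_IVT[of 0 x p] obtain r where "0 < r" "r < x" "poly p r = 0"
          by auto
        with that show ?thesis by (intro exI[of _ r]) auto
      next
        case 2
        with x(2) poly_IVT[of x 0 p] obtain r where "x < r" "r < 0" "poly p r = 0"
          by auto
        with that show ?thesis by (intro exI[of _ r]) auto
      qed
      with False show False by blast
    qed
    have closed_int: "0 \<le> c * poly p x" if "x \<in> {-1..1}" for x
    proof (rule continuous_ge_on_closure[where S = "{-1<..<1}" and f = "\<lambda>x. c * poly p x"])
      show "continuous_on (closure {-1<..<1}) (\<lambda>x. c * poly p x)"
        by (intro continuous_intros)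
      show "x \<in> closure {-1<..<1}"
        using that by simp
      show "0 \<le> c * poly p y" if "y \<in> {-1<..<1}" for y
        using open_int[OF that] .
    qed
    have "c \<noteq> 0" using p0 by (simp add: c_def sgn_0_0)
    show ?thesis
    proof (intro exI[of _ "[:c:]"] conjI allI impI)
      show "0 \<le> poly p x * poly [:c:] x" if "-1 \<le> x \<and> x \<le> 1" for x
        using closed_int[of x] that by (simp add: mult.commute)
      show "0 < (- 1) ^ degree [:c:] * (poly [:c:] 1 * poly [:c:] (- 1))"
        using \<open>c \<noteq> 0\<close>
        by (simp add: zero_less_mult_iff linorder_neq_iff disj_commute)
    qed (use \<open>c \<noteq> 0\<close> in auto)
  qed
qed

text \<open>
  If \<open>\<pi> m\<close> had the same sign at both endpoints, its sign factor would have even degree,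
  hence degree less than \<open>m\<close>, and would be orthogonal to \<open>\<pi> m\<close>, although the
  product of the two is nonnegative and not zero.
\<close>

lemma orthogonal_polynomial_endpoint_signs:
  assumes w: "weight_function (-1) 1 \<omega>" and orth: "orthogonal_polynomials (-1) 1 \<omega> \<pi>"
    and "odd m"
  shows "poly (\<pi> m) 1 * poly (\<pi> m) (-1) \<le> 0"
proof (rule ccontr)
  assume "\<not> ?thesis"
  then have pos: "0 < poly (\<pi> m) 1 * poly (\<pi> m) (-1)" by simp
  then have nz: "\<pi> m \<noteq> 0" by auto
  then obtain q where q: "q \<noteq> 0" "degree q \<le> degree (\<pi> m)"
    and nonneg: "\<And>x. -1 \<le> x \<Longrightarrow> x \<le> 1 \<Longrightarrow> 0 \<le> poly (\<pi> m * q) x"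
    and sgn: "(-1) ^ degree q * (poly q 1 * poly q (-1)) > 0"
    using poly_sign_factor[of "\<pi> m"] by auto
  have "0 \<le> poly (\<pi> m * q) 1 * poly (\<pi> m * q) (-1)"
    using nonneg[of 1] nonneg[of "-1"] by simp
  then have "0 \<le> (poly (\<pi> m) 1 * poly (\<pi> m) (-1)) * (poly q 1 * poly q (-1))"
    by (simp add: mult_ac)
  then have "0 \<le> poly q 1 * poly q (-1)"
    using pos by (simp add: zero_le_mult_iff)
  then have "even (degree q)"
    using sgn by (cases "even (degree q)") auto
  then have "degree q < m"
    using q(2) orth \<open>odd m\<close> by (auto simp: orthogonal_polynomials_def order_le_less)
  then have "moment \<omega> (\<pi> m * q) = 0"
    by (rule orthogonal_to_lower_degree[OF w orth])
  then have "\<pi> m * q = 0"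
    using moment_nonneg_eq_0[OF w nonneg] by simp
  then show False using nz q(1) by simp
qed

section \<open>Traces on the edges\<close>

lemma AE_unit_interval_negligible:
  assumes "AE t in lebesgue_on {0..1::real}. P t"
  obtains S where "negligible S" "\<And>t. t \<in> {0..1} - S \<Longrightarrow> P t"
proof -
  have "AE t in lebesgue. t \<in> {0..1} \<longrightarrow> P t"
    using assms by (subst (asm) AE_restrict_space_iff) auto
  then obtain S where "S \<in> null_sets lebesgue" "{t \<in> space lebesgue. \<not> (t \<in> {0..1} \<longrightarrow> P t)} \<subseteq> S"
    by (auto simp: eventually_ae_filter)
  then show ?thesis
    by (intro that[of S]) (auto simp: negligible_iff_null_sets)
qed

lemma AE_unit_intervalI:
  assumes "\<And>t. t \<in> {0<..<1::real} \<Longrightarrow> P t"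
  shows "AE t in lebesgue_on {0..1}. P t"
proof -
  have "AE t in lebesgue. t \<notin> {0, 1::real}"
    by (intro AE_not_in) (simp add: negligible_iff_null_sets[symmetric])
  then have "AE t in lebesgue. t \<in> {0..1} \<longrightarrow> P t"
    by eventually_elim (use assms in force)
  then show ?thesis
    by (subst AE_restrict_space_iff) auto
qed

lemma continuous_AE_eq_imp_eq:
  fixes f g :: "real \<Rightarrow> real"
  assumes "continuous_on {0..1} f" "continuous_on {0..1} g"
    and "AE t in lebesgue_on {0..1}. f t = g t" and "t \<in> {0..1}"
  shows "f t = g t"
proof -
  obtain S where S: "negligible S" "\<And>t. t \<in> {0..1} - S \<Longrightarrow> f t = g t"
    using AE_unit_interval_negligible[OF assms(3)] by blast
  have "integral {0..1} (\<lambda>t. (f t - g t)\<^sup>2) = integral {0..1} (\<lambda>t::real. 0)"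
    by (rule integral_spike[OF S(1)]) (simp add: S(2))
  then have "\<forall>t\<in>{0..1}. (f t - g t)\<^sup>2 = 0"
    using assms(1,2)
    by (subst integral_eq_0_iff[symmetric]) (auto intro!: continuous_intros)
  with assms(4) show ?thesis by auto
qed

text \<open>
  The substitution \<open>t = (x - a) / (b - a)\<close>.  It serves twice below: for \<open>[a, b]\<close>,
  on which the degrees of freedom are defined, and for \<open>[-1, 1]\<close>, on which the orthogonal
  polynomials live.  Functions known only almost everywhere thus stay on \<open>[0, 1]\<close>, and no
  null set has to be transported.
\<close>

lemma set_integral_unit_interval:
  fixes g :: "real \<Rightarrow> real"
  assumes "a < b"
  shows "(LINT x:{a..b}|lebesgue. g ((x - a) / (b - a))) = (b - a) * (LINT t:{0..1}|lebesgue. g t)"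
    and "set_integrable lebesgue {0..1} g \<longleftrightarrow>
           set_integrable lebesgue {a..b} (\<lambda>x. g ((x - a) / (b - a)))"
proof -
  define f where "f = (\<lambda>t. indicator {0..1} t *\<^sub>R g t)"
  have *: "f (- a / (b - a) + 1 / (b - a) * x) = indicator {a..b} x *\<^sub>R g ((x - a) / (b - a))" for x
  proof -
    have "- a / (b - a) + 1 / (b - a) * x = (x - a) / (b - a)"
      by (simp add: diff_divide_distrib)
    moreover have "(x - a) / (b - a) \<in> {0..1} \<longleftrightarrow> x \<in> {a..b}"
      using assms by (simp add: field_simps)
    ultimately show ?thesis
      by (simp only: f_def indicator_def)
  qed
  have c: "1 / (b - a) \<noteq> 0" using assms by simp
  show "(LINT x:{a..b}|lebesgue. g ((x - a) / (b - a))) = (b - a) * (LINT t:{0..1}|lebesgue. g t)"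
    using lebesgue_integral_real_affine[OF c, of f "- a / (b - a)"] assms
    unfolding * by (simp add: set_lebesgue_integral_def f_def)
  show "set_integrable lebesgue {0..1} g \<longleftrightarrow>
      set_integrable lebesgue {a..b} (\<lambda>x. g ((x - a) / (b - a)))"
    using lebesgue_integrable_real_affine_iff[OF c, of f "- a / (b - a)"]
    unfolding * by (simp add: set_integrable_def f_def)
qed

lemma edge_integral_eq_moment:
  assumes w: "weight_function (-1) 1 \<omega>" and "a < b"
    and f: "AE t in lebesgue_on {0..1}. f t = poly Q (2 * t - 1)"
    and g: "AE t in lebesgue_on {0..1}. g t = poly R (2 * t - 1)"
  shows "(LINT x:{a..b}|lebesgue. f ((x - a) / (b - a)) * g ((x - a) / (b - a)) *
            (\<omega> \<circ> affine_map a b) x) = (b - a) / 2 * moment \<omega> (Q * R)"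
proof -
  define G where "G = (\<lambda>t. poly (Q * R) (2 * t - 1) * \<omega> (2 * t - 1))"
  have G: "G ((y - (- 1)) / (1 - (- 1))) = poly (Q * R) y * \<omega> y" for y :: real
    by (simp add: G_def field_simps)
  have int: "set_integrable lebesgue {0..1} G"
    by (subst set_integral_unit_interval(2)[of "-1" 1]) (simp_all only: G weight_poly_integrable[OF w])
  have mom: "moment \<omega> (Q * R) = 2 * (LINT t:{0..1}|lebesgue. G t)"
    using set_integral_unit_interval(1)[of "-1" 1 G] unfolding G moment_def by simp
  have "AE t in lebesgue_on {0..1}. f t * g t * \<omega> (2 * t - 1) = G t"
    using f g by eventually_elim (simp add: G_def)
  then obtain S where S: "negligible S"
    "\<And>t. t \<in> {0..1} - S \<Longrightarrow> f t * g t * \<omega> (2 * t - 1) = G t"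
    using AE_unit_interval_negligible by blast
  have int': "set_integrable lebesgue {0..1} (\<lambda>t. f t * g t * \<omega> (2 * t - 1))"
    using absolutely_integrable_spike[OF int S] .
  have "(LINT t:{0..1}|lebesgue. f t * g t * \<omega> (2 * t - 1)) = (LINT t:{0..1}|lebesgue. G t)"
    unfolding set_lebesgue_integral_eq_integral(2)[OF int] set_lebesgue_integral_eq_integral(2)[OF int']
    by (rule integral_spike[OF S(1)]) (simp add: S(2))
  moreover have "affine_map a b x = 2 * ((x - a) / (b - a)) - 1" for x
    using \<open>a < b\<close> by (simp add: affine_map_def field_simps)
  ultimately show ?thesis
    using set_integral_unit_interval(1)[OF \<open>a < b\<close>, of "\<lambda>t. f t * g t * \<omega> (2 * t - 1)"] mom
    by simp
qed

lemma edge_trace_eq_linepath: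
  assumes "a < b"
  shows "edge_trace v a b i f x = f (linepath (v i) (v (i + 1)) ((x - a) / (b - a)))"
proof -
  have "(b - x) / (b - a) = 1 - (x - a) / (b - a)"
    using assms by (simp add: field_simps)
  then show ?thesis
    by (simp add: edge_trace_def edge_map_def linepath_def)
qed

text \<open>
  On edge number \<open>i\<close> the function \<open>f\<close> is almost everywhere the polynomial \<open>Q i\<close>.
  The polynomial is taken in the variable \<open>2 * t - 1\<close>, which runs through \<open>[-1, 1]\<close>
  when the edge parameter \<open>t\<close> runs through \<open>[0, 1]\<close>, so that it can be compared with the
  orthogonal polynomials directly.
\<close>

definition edge_polys :: "nat \<Rightarrow> (nat \<Rightarrow> real^2) \<Rightarrow> (real^2 \<Rightarrow> real) \<Rightarrow> (nat \<Rightarrow> real poly) \<Rightarrow> bool" where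
  "edge_polys N v f Q \<longleftrightarrow> (\<forall>i\<in>{1..N}. AE t in lebesgue_on {0..1}.
     f (linepath (v i) (v (i + 1)) t) = poly (Q i) (2 * t - 1))"

lemma edge_polysI:
  assumes "\<And>i t. i \<in> {1..N} \<Longrightarrow> t \<in> {0<..<1} \<Longrightarrow>
    f (linepath (v i) (v (i + 1)) t) = poly (Q i) (2 * t - 1)"
  shows "edge_polys N v f Q"
  using assms unfolding edge_polys_def by (blast intro: AE_unit_intervalI)

lemma dof_eq_moment:
  assumes w: "weight_function (-1) 1 \<omega>" and "a < b"
    and "edge_polys N v f Q" "edge_polys N v (\<beta> j) R"
  shows "dof N v a b (\<omega> \<circ> affine_map a b) \<beta> j f = (b - a) / 2 * (\<Sum>i=1..N. moment \<omega> (Q i * R i))"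
  unfolding dof_def sum_distrib_left
proof (rule sum.cong)
  fix i assume "i \<in> {1..N}"
  then show "(LINT x:{a..b}|lebesgue. edge_trace v a b i f x * edge_trace v a b i (\<beta> j) x *
      (\<omega> \<circ> affine_map a b) x) = (b - a) / 2 * moment \<omega> (Q i * R i)"
    unfolding edge_trace_eq_linepath[OF \<open>a < b\<close>]
    using assms(3,4) by (intro edge_integral_eq_moment[OF w \<open>a < b\<close>]) (auto simp: edge_polys_def)
qed simp

lemma moment_cong_edge_polys:
  assumes w: "weight_function (-1) 1 \<omega>"
    and "edge_polys N v f Q" "edge_polys N v g R" "boundary_eq N v f g" "i \<in> {1..N}"
  shows "moment \<omega> (P * Q i) = moment \<omega> (P * R i)"
proof -
  let ?f = "\<lambda>t. f (linepath (v i) (v (i + 1)) t)"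
  have f: "AE t in lebesgue_on {0..1}. ?f t = poly (Q i) (2 * t - 1)"
    using assms by (auto simp: edge_polys_def)
  have g: "AE t in lebesgue_on {0..1}. g (linepath (v i) (v (i + 1)) t) = poly (R i) (2 * t - 1)"
    using assms by (auto simp: edge_polys_def)
  have "AE t in lebesgue_on {0..1}. ?f t = g (linepath (v i) (v (i + 1)) t)"
    using assms by (auto simp: boundary_eq_def)
  with g have f': "AE t in lebesgue_on {0..1}. ?f t = poly (R i) (2 * t - 1)"
    by eventually_elim simp
  have P: "AE t in lebesgue_on {0..1}. poly P (2 * t - 1) = poly P (2 * t - 1)"
    by simp
  show ?thesis
    using edge_integral_eq_moment[OF w zero_less_one P f] edge_integral_eq_moment[OF w zero_less_one P f']
    by simp
qed

lemma S_space_edge_polys: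
  assumes "f \<in> S_space N v m"
  obtains Q where "edge_polys N v f Q" "\<And>i. i \<in> {1..N} \<Longrightarrow> degree (Q i) \<le> m"
proof -
  have "\<forall>i\<in>{1..N}. \<exists>q::real poly. degree q \<le> m \<and>
      (AE t in lebesgue_on {0..1}. f (linepath (v i) (v (i + 1)) t) = poly q t)"
    using assms by (simp add: S_space_def)
  from bchoice[OF this] obtain q :: "nat \<Rightarrow> real poly"
    where q: "\<And>i. i \<in> {1..N} \<Longrightarrow> degree (q i) \<le> m \<and>
      (AE t in lebesgue_on {0..1}. f (linepath (v i) (v (i + 1)) t) = poly (q i) t)"
    by blast
  show ?thesis
  proof (rule that[of "\<lambda>i. pcompose (q i) [:1/2, 1/2:]"])
    have "poly (pcompose p [:1/2, 1/2:]) (2 * t - 1) = poly p t" for p and t :: real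
      by (simp add: poly_pcompose diff_divide_distrib)
    then show "edge_polys N v f (\<lambda>i. pcompose (q i) [:1/2, 1/2:])"
      using q unfolding edge_polys_def by simp
    show "degree (pcompose (q i) [:1/2, 1/2:]) \<le> m" if "i \<in> {1..N}" for i
      using q[OF that] by (simp add: degree_pcompose)
  qed
qed

lemma S_spaceI:
  assumes "\<And>i. i \<in> {1..N} \<Longrightarrow> degree (Q i) \<le> m"
    and eq: "\<And>i t. i \<in> {1..N} \<Longrightarrow> t \<in> {0<..<1} \<Longrightarrow>
      f (linepath (v i) (v (i + 1)) t) = poly (Q i) (2 * t - 1)"
  shows "f \<in> S_space N v m"
  unfolding S_space_def boundary_L2_def mem_Collect_eq
proof (intro conjI ballI)
  fix i assume i: "i \<in> {1..N}"
  let ?f = "\<lambda>t. f (linepath (v i) (v (i + 1)) t)" and ?q = "\<lambda>t. poly (Q i) (2 * t - 1)"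
  have neg: "negligible {0, 1::real}" by simp
  have f: "?f t = ?q t" if "t \<in> {0..1} - {0, 1}" for t
    using that by (intro eq[OF i]) auto
  have "?q absolutely_integrable_on {0..1}"
    by (intro absolutely_integrable_continuous_real continuous_intros)
  then have "?f absolutely_integrable_on {0..1}"
    by (rule absolutely_integrable_spike[OF _ neg f])
  then show "?f \<in> borel_measurable (lebesgue_on {0..1})"
    by (rule absolutely_integrable_imp_borel_measurable) auto
  have "(\<lambda>t. (?q t)\<^sup>2) absolutely_integrable_on {0..1}"
    by (intro absolutely_integrable_continuous_real continuous_intros)
  then show "(\<lambda>t. (?f t)\<^sup>2) absolutely_integrable_on {0..1}"
    by (rule absolutely_integrable_spike[OF _ neg]) (simp only: f)
  show "\<exists>q. degree q \<le> m \<and> (AE t in lebesgue_on {0..1}. ?f t = poly q t)"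
    using assms(1)[OF i] eq[OF i]
    by (intro exI[of _ "pcompose (Q i) [:-1, 2:]"])
       (auto simp: degree_pcompose poly_pcompose algebra_simps intro!: AE_unit_intervalI)
qed

section \<open>Geometry of the polygon\<close>

lemma polygon_vertex_eq:
  assumes "polygon K N v" "k \<in> {1..N + 1}" "l \<in> {1..N + 1}" "v k = v l"
  shows "k = l \<or> (k = 1 \<and> l = N + 1) \<or> (k = N + 1 \<and> l = 1)"
proof -
  have N: "3 \<le> N" "v (N + 1) = v 1" and inj: "inj_on v {1..N}"
    using assms(1) by (auto simp: polygon_def)
  define r where "r = (\<lambda>k. if k = N + 1 then 1 else k)"
  have "v (r k) = v (r l)" using assms(4) N(2) by (auto simp: r_def)
  moreover have "r k \<in> {1..N}" "r l \<in> {1..N}" using assms(2,3) N(1) by (auto simp: r_def)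
  ultimately have "r k = r l" using inj_onD[OF inj] by blast
  then show ?thesis by (auto simp: r_def split: if_splits)
qed

lemma polygon_edge_nondegenerate:
  assumes "polygon K N v" "i \<in> {1..N}"
  shows "v i \<noteq> v (i + 1)"
proof
  assume "v i = v (i + 1)"
  then show False
    using polygon_vertex_eq[OF assms(1), of i "i + 1"] assms by (auto simp: polygon_def)
qed

text \<open>
  The affine function on the plane (by orthogonal projection) that inverts the
  parametrization of edge number \<open>i\<close> over \<open>[0, 1]\<close>.
\<close>

definition edge_param :: "(nat \<Rightarrow> real^2) \<Rightarrow> nat \<Rightarrow> real^2 \<Rightarrow> real" where
  "edge_param v i x = ((x - v i) \<bullet> (v (i + 1) - v i)) / ((v (i + 1) - v i) \<bullet> (v (i + 1) - v i))"

lemma edge_param_linepath: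
  assumes "v i \<noteq> v (i + 1)"
  shows "edge_param v i (linepath (v i) (v (i + 1)) t) = t"
proof -
  have "linepath (v i) (v (i + 1)) t - v i = t *\<^sub>R (v (i + 1) - v i)"
    by (simp add: linepath_def algebra_simps)
  then show ?thesis
    using assms by (simp add: edge_param_def)
qed

lemma polygon_edges_inter:
  assumes "polygon K N v" "i \<in> {1..N}" "j \<in> {1..N}" "i \<noteq> j"
  shows "edge v i \<inter> edge v j = {v i, v (i + 1)} \<inter> {v j, v (j + 1)}"
  using assms unfolding polygon_def by blast

lemma polygon_open_segment_disjoint:
  assumes "polygon K N v" "i \<in> {1..N}" "j \<in> {1..N}" "i \<noteq> j"
  shows "open_segment (v i) (v (i + 1)) \<inter> edge v j = {}"
proof -
  have "open_segment (v i) (v (i + 1)) = edge v i - {v i, v (i + 1)}"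
    by (simp add: open_segment_def edge_def)
  then show ?thesis
    using polygon_edges_inter[OF assms] by blast
qed

lemma linepath_in_edge: "t \<in> {0..1} \<Longrightarrow> linepath (v i) (v (i + 1)) t \<in> edge v i"
  by (simp add: edge_def linepath_in_path)

section \<open>Unisolvence\<close>

text \<open>
  The degrees of freedom decouple over the edges.  Functions in the span of the basis may
  jump at the vertices, so a polynomial on one edge, extended by zero to the other edges, is
  an admissible test function.
\<close>

lemma all_dofs_zero_iff:
  assumes w: "weight_function (-1) 1 \<omega>" and "a < b" and poly: "polygon K N v"
    and basis: "basis_of_S N v k d \<beta>" and f: "edge_polys N v f Q"
  shows "(\<forall>j\<in>{1..d}. dof N v a b (\<omega> \<circ> affine_map a b) \<beta> j f = 0) \<longleftrightarrow>
         (\<forall>i\<in>{1..N}. \<forall>r. degree r \<le> k \<longrightarrow> moment \<omega> (Q i * r) = 0)"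
proof -
  have "\<forall>j\<in>{1..d}. \<exists>R. edge_polys N v (\<beta> j) R \<and> (\<forall>i\<in>{1..N}. degree (R i) \<le> k)"
    using basis S_space_edge_polys unfolding basis_of_S_def by metis
  then obtain R where R: "\<And>j. j \<in> {1..d} \<Longrightarrow> edge_polys N v (\<beta> j) (R j)"
    and degR: "\<And>j i. j \<in> {1..d} \<Longrightarrow> i \<in> {1..N} \<Longrightarrow> degree (R j i) \<le> k"
    by metis
  have dof: "dof N v a b (\<omega> \<circ> affine_map a b) \<beta> j f =
      (b - a) / 2 * (\<Sum>i=1..N. moment \<omega> (Q i * R j i))" if "j \<in> {1..d}" for j
    using dof_eq_moment[where \<beta> = \<beta> and j = j, OF w \<open>a < b\<close> f R[OF that]] .
  show ?thesis
  proof
    assume "\<forall>i\<in>{1..N}. \<forall>r. degree r \<le> k \<longrightarrow> moment \<omega> (Q i * r) = 0"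
    then show "\<forall>j\<in>{1..d}. dof N v a b (\<omega> \<circ> affine_map a b) \<beta> j f = 0"
      using dof degR by simp
  next
    assume L: "\<forall>j\<in>{1..d}. dof N v a b (\<omega> \<circ> affine_map a b) \<beta> j f = 0"
    then have L': "(\<Sum>i=1..N. moment \<omega> (Q i * R j i)) = 0" if "j \<in> {1..d}" for j
      using dof[OF that] that \<open>a < b\<close> by simp
    show "\<forall>i\<in>{1..N}. \<forall>r. degree r \<le> k \<longrightarrow> moment \<omega> (Q i * r) = 0"
    proof (intro ballI allI impI)
      fix i and r :: "real poly" assume i: "i \<in> {1..N}" and r: "degree r \<le> k"
      \<comment> \<open>the open segment is used, because the end points also belong to adjacent edges\<close>
      define h where "h = (\<lambda>x. if x \<in> open_segment (v i) (v (i + 1))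
                              then poly r (2 * edge_param v i x - 1) else 0)"
      define H where "H = (\<lambda>j. if j = i then r else 0)"
      have h: "h (linepath (v j) (v (j + 1)) t) = poly (H j) (2 * t - 1)"
        if "j \<in> {1..N}" "t \<in> {0<..<1}" for j t
      proof (cases "j = i")
        case True
        have "v i \<noteq> v (i + 1)" using polygon_edge_nondegenerate[OF poly i] .
        moreover from this have "linepath (v i) (v (i + 1)) t \<in> open_segment (v i) (v (i + 1))"
          using that by (auto simp: in_segment linepath_def)
        ultimately show ?thesis
          using True edge_param_linepath[of v i t] by (simp add: h_def H_def)
      next
        case False
        have "linepath (v j) (v (j + 1)) t \<in> edge v j"
          using that by (intro linepath_in_edge) auto
        then show ?thesis
          using polygon_open_segment_disjoint[OF poly i that(1)] False by (auto simp: h_def H_def)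
      qed
      have "h \<in> S_space N v k"
        by (rule S_spaceI[where Q = H]) (use r h in \<open>auto simp: H_def\<close>)
      then obtain c where c: "boundary_eq N v h (\<lambda>x. \<Sum>j=1..d. c j * \<beta> j x)"
        using basis unfolding basis_of_S_def by blast
      have "edge_polys N v (\<lambda>x. \<Sum>j=1..d. c j * \<beta> j x) (\<lambda>i. \<Sum>j=1..d. smult (c j) (R j i))"
        unfolding edge_polys_def
      proof
        fix l assume l: "l \<in> {1..N}"
        have "AE t in lebesgue_on {0..1}. \<forall>j\<in>{1..d}.
                \<beta> j (linepath (v l) (v (l + 1)) t) = poly (R j l) (2 * t - 1)"
          using R l by (subst AE_finite_all) (auto simp: edge_polys_def)
        then show "AE t in lebesgue_on {0..1}. (\<Sum>j=1..d. c j * \<beta> j (linepath (v l) (v (l + 1)) t))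
                     = poly (\<Sum>j=1..d. smult (c j) (R j l)) (2 * t - 1)"
          by eventually_elim (simp add: poly_sum)
      qed
      then have *: "moment \<omega> (Q l * H l) = moment \<omega> (Q l * (\<Sum>j=1..d. smult (c j) (R j l)))"
        if "l \<in> {1..N}" for l
        using moment_cong_edge_polys[OF w edge_polysI[of N h v H] _ c that] h by blast
      have "moment \<omega> (Q i * r) = (\<Sum>l=1..N. if l = i then moment \<omega> (Q l * H l) else 0)"
        using i by (simp add: sum.delta H_def)
      also have "\<dots> = (\<Sum>l=1..N. moment \<omega> (Q l * H l))"
        by (intro sum.cong) (auto simp: H_def)
      also have "\<dots> = (\<Sum>l=1..N. moment \<omega> (Q l * (\<Sum>j=1..d. smult (c j) (R j l))))"
        using * by (intro sum.cong) auto
      also have "\<dots> = (\<Sum>l=1..N. \<Sum>j=1..d. c j * moment \<omega> (Q l * R j l))"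
        by (simp add: sum_distrib_left moment_sum[OF w])
      also have "\<dots> = (\<Sum>j=1..d. c j * (\<Sum>l=1..N. moment \<omega> (Q l * R j l)))"
        by (subst sum.swap) (simp add: sum_distrib_left)
      also have "\<dots> = 0"
        using L' by simp
      finally show "moment \<omega> (Q i * r) = 0" .
    qed
  qed
qed

text \<open>
  A function with vanishing degrees of freedom is \<open>c i\<close> times \<open>\<pi> m\<close> on edge number
  \<open>i\<close>, so its absolute values at the two ends of that edge differ by
  \<open>\<bar>c i\<bar>\<close> times a nonzero constant that is the same for all edges.  Around the
  closed boundary these differences add up to zero.
\<close>

lemma unisolvent:
  assumes poly: "polygon K N v" and w: "weight_function (-1) 1 \<omega>"
    and orth: "orthogonal_polynomials (-1) 1 \<omega> \<pi>" and "a < b" and "0 < m"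
    and basis: "basis_of_S N v (m - 1) (m * N) \<beta>"
    and ne: "\<bar>poly (\<pi> m) 1\<bar> \<noteq> \<bar>poly (\<pi> m) (-1)\<bar>"
  shows "defines_finite_element (A_triple K N v m a b (\<omega> \<circ> affine_map a b) \<beta>)"
  unfolding defines_finite_element_def A_triple_def prod.case
proof (intro ballI impI)
  fix p x
  assume p: "p \<in> S0_space K N v m" and L: "\<forall>L\<in>dof N v a b (\<omega> \<circ> affine_map a b) \<beta> ` {1..m * N}. L p = 0"
    and x: "x \<in> frontier K"
  have front: "frontier K = (\<Union>i\<in>{1..N}. edge v i)" and N: "3 \<le> N" "v (N + 1) = v 1"
    using poly by (auto simp: polygon_def)
  obtain Q where Q: "edge_polys N v p Q" "\<And>i. i \<in> {1..N} \<Longrightarrow> degree (Q i) \<le> m"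
    using p S_space_edge_polys[of p N v m] by (auto simp: S0_space_def)
  have "\<exists>c. Q i = smult c (\<pi> m)" if "i \<in> {1..N}" for i
  proof (rule orthogonal_to_lower_degree_imp_multiple[OF w orth Q(2)[OF that] \<open>0 < m\<close>])
    fix r :: "real poly" assume "degree r < m"
    then have "degree r \<le> m - 1" by simp
    then show "moment \<omega> (Q i * r) = 0"
      using all_dofs_zero_iff[OF w \<open>a < b\<close> poly basis Q(1)] L that by auto
  qed
  then obtain c where c: "\<And>i. i \<in> {1..N} \<Longrightarrow> Q i = smult (c i) (\<pi> m)"
    by metis
  have p_eq: "p (linepath (v i) (v (i + 1)) t) = c i * poly (\<pi> m) (2 * t - 1)"
    if "i \<in> {1..N}" "t \<in> {0..1}" for i t
  proof (rule continuous_AE_eq_imp_eq[where f = "\<lambda>t. p (linepath (v i) (v (i + 1)) t)"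
        and g = "\<lambda>t. c i * poly (\<pi> m) (2 * t - 1)", OF _ _ _ that(2)])
    have "continuous_on (frontier K) p"
      using p by (simp add: S0_space_def)
    then show "continuous_on {0..1} (\<lambda>t. p (linepath (v i) (v (i + 1)) t))"
    proof (rule continuous_on_compose2[OF _ continuous_on_linepath])
      show "linepath (v i) (v (i + 1)) ` {0..1} \<subseteq> frontier K"
        unfolding front using linepath_in_edge that(1) by blast
    qed
    show "continuous_on {0..1} (\<lambda>t. c i * poly (\<pi> m) (2 * t - 1))"
      by (intro continuous_intros)
    have "AE t in lebesgue_on {0..1}. p (linepath (v i) (v (i + 1)) t) = poly (Q i) (2 * t - 1)"
      using Q(1) that(1) unfolding edge_polys_def by blast
    then show "AE t in lebesgue_on {0..1}.
        p (linepath (v i) (v (i + 1)) t) = c i * poly (\<pi> m) (2 * t - 1)"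
      unfolding c[OF that(1)] by simp
  qed
  define A B where "A = \<bar>poly (\<pi> m) 1\<bar>" and "B = \<bar>poly (\<pi> m) (-1)\<bar>"
  have vert: "\<bar>p (v i)\<bar> = \<bar>c i\<bar> * B" "\<bar>p (v (Suc i))\<bar> = \<bar>c i\<bar> * A" if "i \<in> {1..N}" for i
    using p_eq[OF that, of 0] p_eq[OF that, of 1]
    by (simp_all add: linepath_def A_def B_def abs_mult)
  have "(\<Sum>i=1..N. \<bar>c i\<bar>) * (A - B) = (\<Sum>i=1..N. \<bar>p (v (Suc i))\<bar> - \<bar>p (v i)\<bar>)"
    unfolding sum_distrib_right by (rule sum.cong) (simp_all add: vert right_diff_distrib)
  also have "\<dots> = \<bar>p (v (Suc N))\<bar> - \<bar>p (v 1)\<bar>"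
    by (intro sum_Suc_diff) simp
  also have "\<dots> = 0" using N by simp
  finally have "(\<Sum>i=1..N. \<bar>c i\<bar>) = 0"
    using ne by (simp add: A_def B_def)
  then have c0: "c i = 0" if "i \<in> {1..N}" for i
    using that by (simp add: sum_nonneg_eq_0_iff)
  obtain i where i: "i \<in> {1..N}" "x \<in> edge v i"
    using x front by auto
  then obtain t where "t \<in> {0..1}" "x = linepath (v i) (v (i + 1)) t"
    by (auto simp: edge_def linepath_image_01[symmetric])
  then show "p x = 0"
    using p_eq[OF i(1)] c0[OF i(1)] by simp
qed

text \<open>
  If \<open>\<pi> m\<close> takes opposite values at the endpoints, the function that is \<open>\<pi> m\<close>
  with alternating sign on consecutive edges is continuous at all vertices; it closes up at
  the first vertex because the number of edges is even.  It is not zero, but all its degrees of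
  freedom vanish by orthogonality.
\<close>

lemma not_unisolvent:
  assumes poly: "polygon K N v" and "even N" and w: "weight_function (-1) 1 \<omega>"
    and orth: "orthogonal_polynomials (-1) 1 \<omega> \<pi>" and "a < b" and "0 < m"
    and basis: "basis_of_S N v (m - 1) (m * N) \<beta>"
    and 0: "poly (\<pi> m) 1 + poly (\<pi> m) (-1) = 0"
  shows "\<not> defines_finite_element (A_triple K N v m a b (\<omega> \<circ> affine_map a b) \<beta>)"
proof
  assume fe: "defines_finite_element (A_triple K N v m a b (\<omega> \<circ> affine_map a b) \<beta>)"
  have front: "frontier K = (\<Union>i\<in>{1..N}. edge v i)" and N: "3 \<le> N" "v (N + 1) = v 1"
    using poly by (auto simp: polygon_def)
  have deg: "degree (\<pi> m) = m"
    using orth by (simp add: orthogonal_polynomials_def)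
  define h where "h = (\<lambda>i x. (-1) ^ i * poly (\<pi> m) (2 * edge_param v i x - 1))"
  \<comment> \<open>the common value at vertex \<open>k\<close> of the two pieces that meet there\<close>
  define g where "g = (\<lambda>k::nat. (-1) ^ k * poly (\<pi> m) (-1))"
  have h: "h i (linepath (v i) (v (i + 1)) t) = poly (smult ((-1) ^ i) (\<pi> m)) (2 * t - 1)"
    if "i \<in> {1..N}" for i t
    using edge_param_linepath[OF polygon_edge_nondegenerate[OF poly that]] by (simp add: h_def)
  have hv: "h i (v i) = g i" "h i (v (i + 1)) = g (i + 1)" if "i \<in> {1..N}" for i
    using h[OF that, of 0] h[OF that, of 1] eq_neg_iff_add_eq_0[THEN iffD2, OF 0]
    by (simp_all add: linepath_def g_def)
  have g_eq: "g k = g l" if "k \<in> {1..N+1}" "l \<in> {1..N+1}" "v k = v l" for k l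
    using polygon_vertex_eq[OF poly that] \<open>even N\<close> by (auto simp: g_def)
  have agree: "h i x = h j x" if "i \<in> {1..N}" "j \<in> {1..N}" "x \<in> edge v i" "x \<in> edge v j" for i j x
  proof (cases "i = j")
    case False
    then have "x \<in> {v i, v (i + 1)} \<inter> {v j, v (j + 1)}"
      using polygon_edges_inter[OF poly that(1,2)] that(3,4) by blast
    then obtain k l where "k \<in> {i, i + 1}" "l \<in> {j, j + 1}" "x = v k" "x = v l" by blast
    moreover have "h i x = g k" using calculation hv[OF that(1)] by auto
    moreover have "h j x = g l" using calculation hv[OF that(2)] by auto
    ultimately show ?thesis using g_eq[of k l] that by auto
  qed simp
  define p where "p = (\<lambda>x. h (SOME i. i \<in> {1..N} \<and> x \<in> edge v i) x)"
  have p: "p x = h i x" if "i \<in> {1..N}" "x \<in> edge v i" for i x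
  proof -
    have "(SOME i. i \<in> {1..N} \<and> x \<in> edge v i) \<in> {1..N} \<and> x \<in> edge v (SOME i. i \<in> {1..N} \<and> x \<in> edge v i)"
      by (rule someI[of _ i]) (use that in blast)
    then show ?thesis
      unfolding p_def using agree that by blast
  qed
  have p_lin: "p (linepath (v i) (v (i + 1)) t) = poly (smult ((-1) ^ i) (\<pi> m)) (2 * t - 1)"
    if "i \<in> {1..N}" "t \<in> {0..1}" for i t
    using p[OF that(1) linepath_in_edge[OF that(2)]] h[OF that(1)] by simp
  have "continuous_on (frontier K) p"
    unfolding front
  proof (rule continuous_on_closed_Union)
    fix i assume i: "i \<in> {1..N}"
    show "closed (edge v i)" by (simp add: edge_def)
    have "continuous_on (edge v i) (h i)"
      unfolding h_def edge_param_def
      by (intro continuous_intros) (use polygon_edge_nondegenerate[OF poly i] in auto)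
    then show "continuous_on (edge v i) p"
      using p[OF i] by (simp cong: continuous_on_cong)
  qed simp
  moreover have "p \<in> S_space N v m"
    by (rule S_spaceI[where Q = "\<lambda>i. smult ((-1) ^ i) (\<pi> m)"]) (use deg p_lin in auto)
  ultimately have pS: "p \<in> S0_space K N v m"
    by (simp add: S0_space_def)
  have "edge_polys N v p (\<lambda>i. smult ((-1) ^ i) (\<pi> m))"
    using p_lin by (intro edge_polysI) auto
  from all_dofs_zero_iff[OF w \<open>a < b\<close> poly basis this]
  have "\<forall>j\<in>{1..m * N}. dof N v a b (\<omega> \<circ> affine_map a b) \<beta> j p = 0"
    using orthogonal_to_lower_degree[OF w orth] \<open>0 < m\<close> by auto
  with fe pS have p0: "\<forall>x\<in>frontier K. p x = 0"
    by (auto simp: defines_finite_element_def A_triple_def)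
  have root: "poly (\<pi> m) y = 0" if "y \<in> {-1..1}" for y
  proof -
    have 1: "1 \<in> {1..N}" and t: "(y + 1) / 2 \<in> {0..1}" using N that by auto
    have "p (linepath (v 1) (v (1 + 1)) ((y + 1) / 2)) = 0"
      using p0 linepath_in_edge[OF t, of v 1] 1 unfolding front by blast
    moreover have "2 * ((y + 1) / 2) - 1 = y"
      by (simp add: field_simps)
    ultimately show ?thesis
      using p_lin[OF 1 t] by simp
  qed
  have "\<pi> m \<noteq> 0" using deg \<open>0 < m\<close> by auto
  then have "finite {-1..1::real}"
    using root by (intro finite_subset[OF _ poly_roots_finite[of "\<pi> m"]]) auto
  then show False
    by (simp add: infinite_Icc)
qed

section \<open>The remaining characterizations\<close>

lemma affine_map_endpoints:
  assumes "a < b"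
  shows "affine_map a b a = -1" "affine_map a b b = 1"
  using assms by (simp_all add: affine_map_def field_simps)

text \<open>The function \<open>p_tilde\<close> is the derivative of \<open>affine_map\<close> times the rescaled polynomial.\<close>

lemma integral_p_tilde:
  assumes "a < b"
  shows "(LINT x:{a..b}|lebesgue. p_tilde \<pi> m a b x) = poly (\<pi> m) 1 + poly (\<pi> m) (-1)"
proof -
  let ?\<phi> = "affine_map a b"
  have d\<phi>: "(?\<phi> has_real_derivative - 2 / (a - b)) (at x)" for x
    unfolding affine_map_def by (intro DERIV_cdivide) (auto intro!: derivative_eq_intros)
  have dr: "(rescaled \<pi> m a b has_real_derivative poly (pderiv (\<pi> m)) (?\<phi> x) * (- 2 / (a - b))) (at x)" for x
    unfolding rescaled_def using DERIV_chain2[OF poly_DERIV d\<phi>] .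
  have pt: "p_tilde \<pi> m a b x = ?\<phi> x * (poly (pderiv (\<pi> m)) (?\<phi> x) * (- 2 / (a - b)))
              + - 2 / (a - b) * poly (\<pi> m) (?\<phi> x)" for x
    using DERIV_imp_deriv[OF dr, of x] by (simp add: p_tilde_def rescaled_def affine_map_def)
  have "((\<lambda>x. ?\<phi> x * rescaled \<pi> m a b x) has_real_derivative p_tilde \<pi> m a b x) (at x)" for x
    using DERIV_mult[OF d\<phi> dr, of x] unfolding pt by (simp add: rescaled_def algebra_simps)
  then have "((\<lambda>x. p_tilde \<pi> m a b x) has_integral
      (?\<phi> b * rescaled \<pi> m a b b - ?\<phi> a * rescaled \<pi> m a b a)) {a..b}"
    using assms
    by (intro fundamental_theorem_of_calculus)
       (auto simp: has_real_derivative_iff_has_vector_derivative[symmetric] intro: has_field_derivative_at_within)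
  moreover have "(\<lambda>x. p_tilde \<pi> m a b x) absolutely_integrable_on {a..b}"
    unfolding pt affine_map_def using assms
    by (intro absolutely_integrable_continuous_real continuous_intros) auto
  ultimately show ?thesis
    using affine_map_endpoints[OF assms]
    by (simp add: set_lebesgue_integral_eq_integral(2) integral_unique rescaled_def)
qed

lemma poly_1_add_poly_minus_1:
  fixes p :: "real poly"
  shows "poly p 1 + poly p (-1) = 2 * (\<Sum>\<nu> | \<nu> \<le> degree p \<and> even \<nu>. coeff p \<nu>)"
proof -
  have "poly p 1 + poly p (-1) = (\<Sum>\<nu>\<le>degree p. if even \<nu> then 2 * coeff p \<nu> else 0)"
    unfolding poly_altdef sum.distrib[symmetric] by (intro sum.cong) auto
  also have "\<dots> = (\<Sum>\<nu>\<in>{\<nu>\<in>{..degree p}. even \<nu>}. 2 * coeff p \<nu>)"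
    by (subst sum.inter_filter) auto
  finally show ?thesis
    by (simp add: sum_distrib_left)
qed

theorem corollary5:
  fixes m N :: nat and K :: "(real^2) set" and v :: "nat \<Rightarrow> real^2"
    and a b :: real and \<omega> :: "real \<Rightarrow> real" and \<pi> :: "nat \<Rightarrow> real poly"
    and \<beta> :: "nat \<Rightarrow> real^2 \<Rightarrow> real"
  assumes "odd m" and "even N" and "polygon K N v"
    and "weight_function (-1) 1 \<omega>" and "orthogonal_polynomials (-1) 1 \<omega> \<pi>"
    and "a < b"
    and "basis_of_S N v (m - 1) (m * N) \<beta>"
  shows "(defines_finite_element (A_triple K N v m a b (\<omega> \<circ> affine_map a b) \<beta>) \<longleftrightarrow>
            rescaled \<pi> m a b b + rescaled \<pi> m a b a \<noteq> 0) \<and>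
         (rescaled \<pi> m a b b + rescaled \<pi> m a b a \<noteq> 0 \<longleftrightarrow>
            (LINT x:{a..b}|lebesgue. p_tilde \<pi> m a b x) \<noteq> 0) \<and>
         ((LINT x:{a..b}|lebesgue. p_tilde \<pi> m a b x) \<noteq> 0 \<longleftrightarrow>
            (\<Sum>\<nu> | \<nu> \<le> m \<and> even \<nu>. coeff (\<pi> m) \<nu>) \<noteq> 0)"
proof -
  have "0 < m"
    using \<open>odd m\<close> by (rule odd_pos)
  have res: "rescaled \<pi> m a b b + rescaled \<pi> m a b a = poly (\<pi> m) 1 + poly (\<pi> m) (-1)"
    using affine_map_endpoints[OF \<open>a < b\<close>] by (simp add: rescaled_def)
  have deg: "degree (\<pi> m) = m"
    using assms by (simp add: orthogonal_polynomials_def)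
  have coeffs: "poly (\<pi> m) 1 + poly (\<pi> m) (-1) = 2 * (\<Sum>\<nu> | \<nu> \<le> m \<and> even \<nu>. coeff (\<pi> m) \<nu>)"
    using poly_1_add_poly_minus_1[of "\<pi> m"] deg by simp
  have "\<bar>poly (\<pi> m) 1\<bar> \<noteq> \<bar>poly (\<pi> m) (-1)\<bar>" if "poly (\<pi> m) 1 + poly (\<pi> m) (-1) \<noteq> 0"
  proof
    assume "\<bar>poly (\<pi> m) 1\<bar> = \<bar>poly (\<pi> m) (-1)\<bar>"
    with that have eq: "poly (\<pi> m) 1 = poly (\<pi> m) (-1)" by linarith
    with orthogonal_polynomial_endpoint_signs[OF assms(4,5,1)]
    have "poly (\<pi> m) (-1) = 0" by (auto simp: mult_le_0_iff)
    with that eq show False by simp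
  qed
  then have "defines_finite_element (A_triple K N v m a b (\<omega> \<circ> affine_map a b) \<beta>) \<longleftrightarrow>
               poly (\<pi> m) 1 + poly (\<pi> m) (-1) \<noteq> 0"
    using unisolvent[OF assms(3,4,5,6) \<open>0 < m\<close> assms(7)]
      not_unisolvent[OF assms(3,2,4,5,6) \<open>0 < m\<close> assms(7)] by blast
  with res coeffs integral_p_tilde[OF \<open>a < b\<close>, of \<pi> m] show ?thesis
    by simp
qed

end
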